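(* Let $H$ be a finite $3$-uniform hypergraph that is $(6,2)$-sparse and in which any two distinct hyperedges share at most one vertex. Then $H$ is metric.
   Context: Given a metric space $M=(X,\rho)$ and three distinct points $x,y,z\in X$, $y$ is said to be between $x$ and $z$ if $\rho(x,z)=\rho(x,y)+\rho(y,z)$; the triple $\{x,y,z\}$ is collinear if one of its points is between the other two. The hypergraph $H_M$ associated with $M$ is the $3$-uniform hypergraph whose vertices are the points of $M$ and whose hyperedges are exactly the collinear triples of $M$. A $3$-uniform hypergraph $H$ is metric if there is a metric space $M$ with $H_M=H$. A $3$-uniform hypergraph is $(k,\ell)$-sparse if every $k$-element subset $X$ of its vertices contains at most $\ell$ hyperedges with all their vertices in $X$. *)

theory Defs
  imports "HOL-Analysis.Analysis"
begin

text \<open>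
  A hypergraph is a pair \<open>(V, E)\<close> of a vertex set and a set of hyperedges. A metric space is a
  carrier \<open>X\<close> with a distance \<open>d\<close> satisfying the library locale \<^locale>\<open>Metric_space\<close>.
\<close>

definition hypergraph3 :: "'a set \<times> 'a set set \<Rightarrow> bool" where
  "hypergraph3 H \<longleftrightarrow> (\<forall>e\<in>snd H. e \<subseteq> fst H \<and> card e = 3)"

definition metric_between :: "('a \<Rightarrow> 'a \<Rightarrow> real) \<Rightarrow> 'a \<Rightarrow> 'a \<Rightarrow> 'a \<Rightarrow> bool" where
  "metric_between d x y z \<longleftrightarrow>
     x \<noteq> y \<and> y \<noteq> z \<and> x \<noteq> z \<and> d x z = d x y + d y z"

text \<open>The bound variables range over all orderings of a triple, so the point in the middle
  position may be any of the three.\<close>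

definition collinear_triples :: "'a set \<Rightarrow> ('a \<Rightarrow> 'a \<Rightarrow> real) \<Rightarrow> 'a set set" where
  "collinear_triples X d =
     {{x, y, z} |x y z. x \<in> X \<and> y \<in> X \<and> z \<in> X \<and> metric_between d x y z}"

definition metric_hypergraph :: "'a set \<Rightarrow> ('a \<Rightarrow> 'a \<Rightarrow> real) \<Rightarrow> 'a set \<times> 'a set set" where
  "metric_hypergraph X d = (X, collinear_triples X d)"

definition is_metric :: "'a set \<times> 'a set set \<Rightarrow> bool" where
  "is_metric H \<longleftrightarrow> (\<exists>X d. Metric_space X d \<and> metric_hypergraph X d = H)"

text \<open>Finiteness of \<open>X\<close> is explicit because \<^const>\<open>card\<close> is \<open>0\<close> on infinite sets.\<close>

definition sparse_hypergraph :: "nat \<Rightarrow> nat \<Rightarrow> 'a set \<times> 'a set set \<Rightarrow> bool" where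
  "sparse_hypergraph k l H \<longleftrightarrow>
     (\<forall>X. X \<subseteq> fst H \<and> finite X \<and> card X = k \<longrightarrow> card {e \<in> snd H. e \<subseteq> X} \<le> l)"

end

theory Submission
  imports Defs
begin

text \<open>
  Pick a vertex of every hyperedge as its midpoint. Give a pair of vertices distance \<open>1\<close> if it lies
  in a hyperedge and contains its midpoint, \<open>2\<close> if it lies in a hyperedge but misses the midpoint,
  and \<open>3/2\<close> otherwise. Hyperedges are then collinear. By sparseness three hyperedges never form
  a triangle, so any other triple contains a pair at distance \<open>3/2\<close>; as the remaining two distances
  are among \<open>1\<close>, \<open>3/2\<close>, \<open>2\<close>, all three triangle inequalities are strict.
\<close>

lemma linear_hypergraph_edge_unique:
  assumes "\<forall>e\<in>E. \<forall>f\<in>E. e \<noteq> f \<longrightarrow> card (e \<inter> f) \<le> 1" and "hypergraph3 (V, E)"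
    and "e \<in> E" "f \<in> E" "{x, y} \<subseteq> e" "{x, y} \<subseteq> f" "x \<noteq> y"
  shows "e = f"
proof (rule ccontr)
  assume "e \<noteq> f"
  have "finite e"
    using assms(2,3) by (auto simp: hypergraph3_def intro: card_ge_0_finite)
  then have "card {x, y} \<le> card (e \<inter> f)"
    using assms(5,6) by (intro card_mono) auto
  moreover have "card (e \<inter> f) \<le> 1"
    using assms(1,3,4) \<open>e \<noteq> f\<close> by blast
  ultimately show False
    using \<open>x \<noteq> y\<close> by simp
qed

text \<open>If the corners did not form an edge, each of \<open>e\<close>, \<open>f\<close>,
  \<open>g\<close> would have a third vertex off the triangle. Linearity makes these three vertices
  distinct, so six vertices would carry three hyperedges, one more than sparseness permits.\<close>

lemma sparse_linear_hypergraph_no_triangle: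
  assumes hyper: "hypergraph3 (V, E)" and sparse: "sparse_hypergraph 6 2 (V, E)"
    and linear: "\<forall>e\<in>E. \<forall>f\<in>E. e \<noteq> f \<longrightarrow> card (e \<inter> f) \<le> 1"
    and edges: "e \<in> E" "f \<in> E" "g \<in> E"
    and mem: "{x, y} \<subseteq> e" "{y, z} \<subseteq> f" "{x, z} \<subseteq> g"
    and distinct: "x \<noteq> y" "y \<noteq> z" "x \<noteq> z"
  shows "{x, y, z} \<in> E"
proof (rule ccontr)
  assume nonedge: "{x, y, z} \<notin> E"
  have third: "\<exists>c. h = {a, b, c} \<and> c \<noteq> a \<and> c \<noteq> b"
    if "h \<in> E" "{a, b} \<subseteq> h" "a \<noteq> b" for h a b
  proof -
    have "card h = 3" using hyper that(1) by (simp add: hypergraph3_def)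
    then have "card (h - {a, b}) = 1"
      using that(2,3) by (simp add: card_Diff_subset)
    then obtain c where "h - {a, b} = {c}"
      by (rule card_1_singletonE)
    then show ?thesis using that(2) by blast
  qed
  obtain c where c: "e = {x, y, c}" "c \<noteq> x" "c \<noteq> y"
    using third[OF edges(1) mem(1) distinct(1)] by blast
  obtain a where a: "f = {y, z, a}" "a \<noteq> y" "a \<noteq> z"
    using third[OF edges(2) mem(2) distinct(2)] by blast
  obtain b where b: "g = {x, z, b}" "b \<noteq> x" "b \<noteq> z"
    using third[OF edges(3) mem(3) distinct(3)] by blast
  have "{x, y, z} = {y, z, x}" "{x, y, z} = {x, z, y}"
    by blast+
  \<comment> \<open>If an edge had the opposite corner as its third vertex, it would be
    \<open>{x, y, z}\<close> itself.\<close>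
  then have out: "c \<noteq> z" "a \<noteq> x" "b \<noteq> y"
    using nonedge edges a(1) b(1) c(1) by metis+
  have "z \<notin> e" "x \<notin> f"
    using a(1) c(1) out distinct by auto
  then have ne: "e \<noteq> f" "f \<noteq> g" "e \<noteq> g"
    using mem by blast+
  note unique = linear_hypergraph_edge_unique[OF linear hyper]
  \<comment> \<open>A common third vertex, together with the corner where the two edges meet, would
    be a pair lying in both.\<close>
  have "a \<noteq> c"
    using unique[OF edges(1,2), of y a] ne(1) a(1,2) c(1) by blast
  moreover have "a \<noteq> b"
    using unique[OF edges(2,3), of z a] ne(2) a(1,3) b(1) by blast
  moreover have "b \<noteq> c"
    using unique[OF edges(1,3), of x b] ne(3) b(1,2) c(1) by blast
  ultimately have card6: "card {x, y, z, a, b, c} = 6"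
    using a(2,3) b(2,3) c(2,3) out distinct by simp
  have "e \<subseteq> V" "f \<subseteq> V" "g \<subseteq> V"
    using hyper edges by (auto simp: hypergraph3_def)
  then have "{x, y, z, a, b, c} \<subseteq> V"
    using a(1) b(1) c(1) by blast
  then have "card {h \<in> E. h \<subseteq> {x, y, z, a, b, c}} \<le> 2"
    using sparse card6 by (simp add: sparse_hypergraph_def)
  moreover have "card {e, f, g} \<le> card {h \<in> E. h \<subseteq> {x, y, z, a, b, c}}"
  proof (rule card_mono)
    show "finite {h \<in> E. h \<subseteq> {x, y, z, a, b, c}}"
      by (rule finite_subset[of _ "Pow {x, y, z, a, b, c}"]) auto
    show "{e, f, g} \<subseteq> {h \<in> E. h \<subseteq> {x, y, z, a, b, c}}"
      using edges a(1) b(1) c(1) by blast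
  qed
  moreover have "card {e, f, g} = 3"
    using ne by simp
  ultimately show False by simp
qed

theorem theorem3:
  fixes V :: "'a set" and E :: "'a set set"
  assumes "hypergraph3 (V, E)"
    and "finite V"
    and "sparse_hypergraph 6 2 (V, E)"
    and "\<forall>e\<in>E. \<forall>f\<in>E. e \<noteq> f \<longrightarrow> card (e \<inter> f) \<le> 1"
  shows "is_metric (V, E)"
proof -
  \<comment> \<open>The midpoint of an edge is an arbitrary element of it; nothing relates the
    choices for different edges.\<close>
  define m where "m e = (SOME v. v \<in> e)" for e :: "'a set"
  define d :: "'a \<Rightarrow> 'a \<Rightarrow> real" where
    "d x y = (if x = y then 0
      else if \<exists>e\<in>E. {x, y} \<subseteq> e then if \<exists>e\<in>E. {x, y} \<subseteq> e \<and> m e \<in> {x, y} then 1 else 2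
      else 3/2)" for x y
  have edge: "e \<subseteq> V" "card e = 3" if "e \<in> E" for e
    using assms(1) that by (auto simp: hypergraph3_def)
  have m_in: "m e \<in> e" if "e \<in> E" for e
    using edge(2)[OF that] unfolding m_def by (auto intro!: some_in_eq[THEN iffD2])
  \<comment> \<open>By linearity \<open>e\<close> is the only edge through the pair, so both
    existentials in \<open>d\<close> reduce to statements about \<open>e\<close>.\<close>
  have d_edge: "d x y = (if m e \<in> {x, y} then 1 else 2)"
    if "e \<in> E" "{x, y} \<subseteq> e" "x \<noteq> y" for e x y
  proof -
    have "f = e" if "f \<in> E" "{x, y} \<subseteq> f" for f
      using linear_hypergraph_edge_unique[OF assms(4,1)] that \<open>e \<in> E\<close> \<open>{x, y} \<subseteq> e\<close> \<open>x \<noteq> y\<close>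
      by blast
    then have "(\<exists>f\<in>E. {x, y} \<subseteq> f \<and> m f \<in> {x, y}) \<longleftrightarrow> m e \<in> {x, y}"
      using that by blast
    moreover have "\<exists>f\<in>E. {x, y} \<subseteq> f"
      using that by blast
    ultimately show ?thesis
      using \<open>x \<noteq> y\<close> by (simp only: d_def if_True if_False)
  qed
  have d_commute: "d x y = d y x" for x y
    unfolding d_def insert_commute[of x y] by (simp only: eq_commute[of x y])
  have d_refl [simp]: "d x x = 0" for x
    by (simp add: d_def)
  have d_bounds: "1 \<le> d x y" "d x y \<le> 2" if "x \<noteq> y" for x y
    using that by (auto simp: d_def)
  have d_free: "d x y = 3/2" if "x \<noteq> y" "\<not> (\<exists>e\<in>E. {x, y} \<subseteq> e)" for x y
    using that by (simp add: d_def)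
  have strict: "d x z < d x y + d y z"
    if ne: "x \<noteq> y" "y \<noteq> z" "x \<noteq> z" and "{x, y, z} \<notin> E" for x y z
  proof -
    have "\<not> ((\<exists>e\<in>E. {x, y} \<subseteq> e) \<and> (\<exists>e\<in>E. {y, z} \<subseteq> e) \<and> (\<exists>e\<in>E. {x, z} \<subseteq> e))"
      using sparse_linear_hypergraph_no_triangle[OF assms(1,3,4) _ _ _ _ _ _ ne] that(4) by blast
    then have "d x y = 3/2 \<or> d y z = 3/2 \<or> d x z = 3/2"
      using d_free ne by blast
    \<comment> \<open>If \<open>d x z\<close> is 3/2, the right side is at least 2; if a summand is
      3/2, the right side is at least 5/2 while \<open>d x z\<close> is at most 2.\<close>
    then show ?thesis
      using d_bounds[OF ne(1)] d_bounds[OF ne(2)] d_bounds[OF ne(3)] by linarith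
  qed
  have triangle: "d x z \<le> d x y + d y z" for x y z
  proof (cases "x = y \<or> y = z \<or> x = z")
    case True
    then show ?thesis using d_bounds[of x y] d_commute[of x y] by force
  next
    case False
    \<comment> \<open>Distances between distinct points lie between 1 and 2, so the sum of any two
      of them is at least the third, whether or not the triple is an edge.\<close>
    then have "d x z \<le> 2" "1 \<le> d x y" "1 \<le> d y z"
      using d_bounds by auto
    then show ?thesis by linarith
  qed
  have "Metric_space V d"
  proof
    show "0 \<le> d x y" for x y by (simp add: d_def)
    show "d x y = d y x" for x y by (rule d_commute)
    show "d x y = 0 \<longleftrightarrow> x = y" for x y by (simp add: d_def)
    show "d x z \<le> d x y + d y z" for x y z by (rule triangle)
  qed
  moreover have "collinear_triples V d = E"
  proof
    show "collinear_triples V d \<subseteq> E"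
    proof
      fix e assume "e \<in> collinear_triples V d"
      then obtain x y z where "e = {x, y, z}" "metric_between d x y z"
        unfolding collinear_triples_def by blast
      \<comment> \<open>Betweenness is an equality, which \<open>strict\<close> rules out for
        triples outside \<open>E\<close>.\<close>
      then show "e \<in> E"
        using strict[of x y z] by (auto simp: metric_between_def)
    qed
    show "E \<subseteq> collinear_triples V d"
    proof
      fix e assume e: "e \<in> E"
      have "card (e - {m e}) = 2"
        using edge(2)[OF e] m_in[OF e] by simp
      then obtain x z where xz: "e - {m e} = {x, z}" "x \<noteq> z"
        by (auto simp: card_2_iff)
      then have mem: "m e \<noteq> x" "m e \<noteq> z" "e = {x, m e, z}"
        using m_in[OF e] by auto
      then have sub: "{x, m e} \<subseteq> e" "{m e, z} \<subseteq> e" "{x, z} \<subseteq> e"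
        by blast+
      \<comment> \<open>This reads 2 = 1 + 1: only the pair \<open>{x, z}\<close> misses the
        midpoint.\<close>
      have "d x z = d x (m e) + d (m e) z"
        using d_edge[OF e sub(1)] d_edge[OF e sub(2)] d_edge[OF e sub(3)] mem xz(2) by auto
      then have "metric_between d x (m e) z"
        using mem xz(2) by (auto simp: metric_between_def)
      then show "e \<in> collinear_triples V d"
        using sub edge(1)[OF e] mem(3) unfolding collinear_triples_def by blast
    qed
  qed
  ultimately show ?thesis
    unfolding is_metric_def metric_hypergraph_def by blast
qed

end
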